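(* Let $\zeta^{(0)}$ be the zeta function associated to the Fubini--Study metric on $\mathbb{P}^1(\mathbb{C})$, i.e. the meromorphic continuation to $\mathbb{C}$ of $$\zeta^{(0)}(s)=\sum_{l=1}^{\infty}\frac{2l+1}{(l(l+1))^s}\qquad(\Re(s)>1).$$ For every integer $m\ge 0$, $$\zeta^{(0)}(-m)=-\frac{1}{m+1}\sum_{k=m+1}^{2m+2}(-1)^k\binom{m+1}{2m+2-k}B_k,$$ where $B_k$ is the $k$-th Bernoulli number.
   Context: The series converges absolutely for $\Re(s)>1$, and $\zeta^{(0)}(-m)$ denotes the value at $s=-m$ of its meromorphic continuation to $\mathbb{C}$, which is holomorphic at the non-positive integers. The series is the spectral zeta function of the Laplacian on functions on $\mathbb{P}^1(\mathbb{C})$ with the Fubini--Study metric (nonzero eigenvalues $l(l+1)$ with multiplicity $2l+1$, $l\ge 1$). The Bernoulli numbers $B_k$ are defined by $\frac{t}{e^t-1}=\sum_{k\ge 0}B_k\frac{t^k}{k!}$, so $B_1=-\tfrac12$. *)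

theory Defs
  imports "HOL-Complex_Analysis.Complex_Analysis"
begin

(* B_k / k! is the k-th coefficient of t / (e^t - 1); in particular B_1 = -1/2. *)
definition bernoulli_number :: "nat \<Rightarrow> real" where
  "bernoulli_number k = fact k * fps_nth (fps_X / (fps_exp 1 - 1)) k"

lemma bernoulli_fps_mult: "(fps_X / (fps_exp 1 - 1)) * (fps_exp 1 - 1) = (fps_X :: real fps)"
proof -
  have s: "subdegree (fps_exp 1 - 1 :: real fps) = 1" by (rule subdegreeI) auto
  have "(fps_exp 1 - 1 :: real fps) \<noteq> 0" using s by auto
  moreover have "(fps_exp 1 - 1 :: real fps) dvd fps_X"
    using s calculation by (subst fps_dvd_iff) auto
  ultimately show ?thesis by simp
qed

lemma bernoulli_number_small:
  "bernoulli_number 0 = 1 \<and> bernoulli_number 1 = -1/2 \<and> bernoulli_number 2 = 1/6"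
proof -
  define f :: "real fps" where "f = fps_X / (fps_exp 1 - 1)"
  have e: "fps_nth (f * (fps_exp 1 - 1)) n = fps_nth fps_X n" for n using bernoulli_fps_mult f_def by simp
  show ?thesis using e[of 1] e[of 2] e[of 3]
    by (simp add: bernoulli_number_def f_def[symmetric] fps_mult_nth numeral_eq_Suc field_simps fact_numeral)
qed

(* The base l (l + 1) is a positive integer, so the principal branch used by powr is the
   real logarithm. For complex-valued families, has_sum means absolute convergence. *)
definition is_fubini_study_zeta :: "(complex \<Rightarrow> complex) \<Rightarrow> bool" where
  "is_fubini_study_zeta Z \<longleftrightarrow>
     Z nicely_meromorphic_on UNIV \<and>
     (\<forall>s. Re s > 1 \<longrightarrow>
        ((\<lambda>l::nat. of_nat (2 * l + 1) / of_nat (l * (l + 1)) powr s) has_sum Z s) {1..})"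

(* nicely_meromorphic_on fixes the values of a meromorphic function: limits at removable
   singularities and 0 at poles, which makes the continuation unique as a total function. *)
lemma is_fubini_study_zeta_unique:
  assumes "is_fubini_study_zeta Z" "is_fubini_study_zeta W"
  shows "Z = W"
proof -
  have a: "Z s = W s" if "Re s > 1" for s
    using assms that unfolding is_fubini_study_zeta_def by (meson has_sum_unique)
  have 1: "frequently (\<lambda>z. Z z = W z) (at 2)"
  proof (rule eventually_frequently)
    have "eventually (\<lambda>z. z \<in> {s. Re s > 1}) (at (2::complex))"
      by (intro eventually_at_in_open') (auto simp: open_halfspace_Re_gt)
    then show "eventually (\<lambda>z. Z z = W z) (at 2)" by eventually_elim (use a in auto)
  qed auto
  have nz: "Z nicely_meromorphic_on UNIV" and nw: "W nicely_meromorphic_on UNIV"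
    using assms unfolding is_fubini_study_zeta_def by auto
  let ?D = "remove_sings (\<lambda>z. Z z - W z)"
  have md: "(\<lambda>z. Z z - W z) meromorphic_on UNIV"
    using nz nw unfolding nicely_meromorphic_on_def by (auto intro!: meromorphic_intros)
  have nd: "?D nicely_meromorphic_on UNIV" by (rule remove_sings_nicely_meromorphic[OF md])
  have ev: "eventually (\<lambda>z. ?D z = Z z - W z) (at x)" for x
    by (rule eventually_remove_sings_eq_at) (rule meromorphic_on_isolated_singularity, rule meromorphic_on_subset[OF md], simp)
  have "frequently (\<lambda>z. ?D z = 0) (at 2)"
    by (rule frequently_rev_mp[OF 1]) (use ev[of 2] in \<open>auto elim: eventually_mono\<close>)
  from frequently_eq_meromorphic_imp_constant[OF this nd] have 0: "?D w = 0" for w by auto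
  have E: "eventually (\<lambda>z. Z z = W z) (at x)" for x
    using ev[of x] by eventually_elim (simp add: 0)
  show ?thesis
  proof
    fix x
    have p: "is_pole Z x = is_pole W x" by (rule is_pole_cong[OF E refl])
    have l: "(Z \<longlongrightarrow> c) (at x) = (W \<longlongrightarrow> c) (at x)" for c by (rule tendsto_cong[OF E])
    have a: "(is_pole Z x \<and> Z x = 0) \<or> Z \<midarrow>x\<rightarrow> Z x" "(is_pole W x \<and> W x = 0) \<or> W \<midarrow>x\<rightarrow> W x"
      using nz nw unfolding nicely_meromorphic_on_def by auto
    show "Z x = W x" using a p l
      by (metis LIM_unique not_tendsto_and_filterlim_at_infinity is_pole_def trivial_limit_at)
  qed
qed

definition fubini_study_zeta :: "complex \<Rightarrow> complex" where
  "fubini_study_zeta = (THE Z. is_fubini_study_zeta Z)"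

end

theory Submission
  imports Defs
begin

text \<open>
  Put \<open>F(z) = (z (z + 1)) powr (1 - s)\<close>, so that \<open>F'(l)\<close> is \<open>1 - s\<close> times the \<open>l\<close>-th summand.
  Euler--Maclaurin summation replaces \<open>F'(l + 1)\<close> by the telescoping sum of
  \<open>c\<^sub>k (F\<^bsup>(k)\<^esup>(l + 1) - F\<^bsup>(k)\<^esup>(l))\<close> with \<open>c\<^sub>k = (-1)\<^sup>k B\<^sub>k / k!\<close>, \<open>k \<le> K\<close>, up to an error controlled
  by \<open>F\<^bsup>(K + 2)\<^esup>\<close>. Cauchy's inequality on the disc of radius \<open>l / 2\<close> makes these errors summable,
  locally uniformly in \<open>Re s > -A\<close> once \<open>K \<ge> 2 A + 2\<close>, so \<open>(1 - s)\<close> times the zeta function extends to an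
  entire function. At \<open>s = -m\<close> the function \<open>F\<close> is the polynomial \<open>(z (z + 1))\<^bsup>m + 1\<^esup>\<close>: all errors
  vanish, also the one at \<open>z = 0\<close>, which turns the boundary terms at \<open>z = 1\<close> into
  \<open>- \<Sum> c\<^sub>k F\<^bsup>(k)\<^esup>(0)\<close>, and the \<open>F\<^bsup>(k)\<^esup>(0) / k!\<close> are binomial coefficients.
\<close>

section \<open>Euler--Maclaurin summation with Taylor remainder\<close>

text \<open>Generating function \<open>x exp x / (exp x - 1)\<close>: the sign turns
  \<open>B_1 = -1/2\<close> into \<open>+1/2\<close>, which fits a summation that takes the
  derivative at the right end point of each unit interval.\<close>

definition em_coeff :: "nat \<Rightarrow> real" where
  "em_coeff k = (- 1) ^ k * bernoulli_number k / fact k"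

text \<open>The identity \<open>B(x) (exp x - 1) = x\<close> for the Bernoulli series, at \<open>-x\<close>.\<close>

lemma em_coeff_fps: "Abs_fps em_coeff * (fps_exp 1 - 1) = fps_X * fps_exp 1"
proof -
  define B :: "real fps" where "B = fps_X / (fps_exp 1 - 1)"
  have B: "B * (fps_exp 1 - 1) = fps_X" unfolding B_def by (rule bernoulli_fps_mult)
  have c: "Abs_fps em_coeff = B oo (- fps_X)"
    by (simp add: fps_eq_iff fps_compose_uminus' em_coeff_def bernoulli_number_def B_def)
  have "(B oo (- fps_X)) * ((fps_exp 1 - 1) oo (- fps_X)) = fps_X oo (- fps_X)"
    by (subst fps_compose_mult_distrib[symmetric]) (simp_all add: B)
  moreover have "(fps_exp (1::real)) oo (- fps_X) = fps_exp (- 1)"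
    by (simp add: fps_eq_iff fps_compose_uminus')
  ultimately have "Abs_fps em_coeff * (fps_exp (- 1) - 1) = - fps_X"
    by (simp add: c fps_compose_sub_distrib)
  hence "(Abs_fps em_coeff * (fps_exp (- 1) - 1)) * fps_exp 1 = - fps_X * fps_exp 1"
    by simp
  moreover have "fps_exp (- 1) * fps_exp (1::real) = 1"
    using fps_exp_add_mult[of "- 1" "1::real"] by simp
  ultimately show ?thesis
    by (simp add: algebra_simps)
qed

text \<open>Comparison of the coefficients of \<open>x^n\<close> in \<open>em_coeff_fps\<close>; the
  term \<open>k = n\<close> drops out because \<open>exp x - 1\<close> has no constant term.\<close>

lemma sum_em_coeff:
  assumes "n \<ge> 1"
  shows "(\<Sum>k<n. em_coeff k / fact (n - k)) = 1 / fact (n - 1)"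
proof -
  obtain m where n: "n = Suc m" using assms by (cases n) auto
  have "fps_nth (Abs_fps em_coeff * (fps_exp 1 - 1)) n = fps_nth (fps_X * fps_exp 1) n"
    by (simp add: em_coeff_fps)
  moreover have "fps_nth (Abs_fps em_coeff * (fps_exp 1 - 1)) n =
      (\<Sum>k\<le>n. if k = n then 0 else em_coeff k / fact (n - k))"
    unfolding fps_mult_nth atMost_atLeast0 by (intro sum.cong) auto
  also have "\<dots> = (\<Sum>k<n. em_coeff k / fact (n - k))"
    unfolding n lessThan_Suc_atMost[symmetric] by (auto intro!: sum.cong)
  finally show ?thesis using n by simp
qed

text \<open>The sequence \<open>f\<close> stands for a function and its successive derivatives, so
  that both complex derivatives on a half plane and formal derivatives of polynomials fit.\<close>

definition em_error :: "nat \<Rightarrow> (nat \<Rightarrow> complex \<Rightarrow> complex) \<Rightarrow> complex \<Rightarrow> complex" where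
  "em_error K f z = f 1 (z + 1) -
     (\<Sum>k\<le>K. of_real (em_coeff k) * (f k (z + 1) - f k z))"

text \<open>By \<open>sum_em_coeff\<close> the Euler--Maclaurin relation is exact for Taylor
  polynomials. Only the Taylor remainders of the \<open>f k\<close> survive, and each is at most
  \<open>B\<close> because the step from \<open>z\<close> to \<open>z + 1\<close> has length
  1.\<close>

lemma em_error_bound:
  fixes f :: "nat \<Rightarrow> complex \<Rightarrow> complex"
  assumes S: "convex S" "z \<in> S" "z + 1 \<in> S"
    and der: "\<And>i x. x \<in> S \<Longrightarrow> (f i has_field_derivative f (Suc i) x) (at x within S)"
    and B: "\<And>x. x \<in> S \<Longrightarrow> norm (f (K + 2) x) \<le> B"
  shows "norm (em_error K f z) \<le> (1 + (\<Sum>k\<le>K. \<bar>em_coeff k\<bar>)) * B"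
proof -
  \<comment> \<open>Truncating at total order \<open>K + 1\<close> makes every remainder involve the
    same derivative \<open>f (K + 2)\<close>.\<close>
  define T where "T k = (\<Sum>i\<le>K + 1 - k. f (k + i) z / fact i)" for k
  have B0: "B \<ge> 0" using B[OF S(2)] norm_ge_zero order_trans by blast
  have tay: "norm (f k (z + 1) - T k) \<le> B" if "k \<le> K + 1" for k
  proof -
    have "norm (f (k + 0) (z + 1) - (\<Sum>i\<le>K + 1 - k. f (k + i) z * ((z + 1) - z) ^ i / fact i))
      \<le> B * norm ((z + 1) - z) ^ Suc (K + 1 - k) / fact (K + 1 - k)"
      by (rule complex_Taylor[where f = "\<lambda>i. f (k + i)", OF S(1)])
        (use der B S that in auto)
    also have "\<dots> \<le> B / 1"
      using B0 by (auto intro!: divide_left_mono simp del: div_by_1)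
    finally show ?thesis by (simp add: T_def)
  qed
  define e where "e k = f k (z + 1) - T k" for k
  define g where "g n = f n z" for n
  have T1: "T 1 = (\<Sum>n = 1..K + 1. g n / fact (n - 1))"
    unfolding T_def g_def
    by (rule sum.reindex_bij_witness[of _ "\<lambda>n. n - 1" Suc]) auto
  have Tk: "T k - f k z = (\<Sum>n = 1..K + 1. if k < n then g n / fact (n - k) else 0)" if "k \<le> K" for k
  proof -
    have "T k = f k z + (\<Sum>i \<in> {1..K + 1 - k}. f (k + i) z / fact i)"
      unfolding T_def atMost_atLeast0 by (subst sum.atLeast_Suc_atMost) auto
    also have "(\<Sum>i \<in> {1..K + 1 - k}. f (k + i) z / fact i) = (\<Sum>n \<in> {k+1..K + 1}. g n / fact (n - k))"
      unfolding g_def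
      by (rule sum.reindex_bij_witness[of _ "\<lambda>n. n - k" "\<lambda>i. k + i"]) auto
    also have "\<dots> = (\<Sum>n \<in> {n \<in> {1..K + 1}. k < n}. g n / fact (n - k))"
      by (intro sum.cong) auto
    also have "\<dots> = (\<Sum>n = 1..K + 1. if k < n then g n / fact (n - k) else 0)"
      by (rule sum.inter_filter) auto
    finally show ?thesis by simp
  qed
  have "(\<Sum>k\<le>K. of_real (em_coeff k) * (T k - f k z)) =
      (\<Sum>k\<le>K. \<Sum>n = 1..K + 1. if k < n then of_real (em_coeff k) * (g n / fact (n - k)) else 0)"
    by (intro sum.cong) (auto simp: Tk sum_distrib_left if_distrib simp del: sum.cl_ivl_Suc cong: if_cong)
  also have "\<dots> = (\<Sum>n = 1..K + 1. \<Sum>k\<le>K. if k < n then of_real (em_coeff k) * (g n / fact (n - k)) else 0)"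
    by (rule sum.swap)
  also have "\<dots> = (\<Sum>n = 1..K + 1. g n / fact (n - 1))"
  proof (intro sum.cong refl)
    fix n assume n: "n \<in> {1..K + 1}"
    have "(\<Sum>k\<le>K. if k < n then of_real (em_coeff k) * (g n / fact (n - k)) else 0) =
        (\<Sum>k \<in> {k \<in> {..K}. k < n}. of_real (em_coeff k) * (g n / fact (n - k)))"
      by (rule sum.inter_filter[symmetric]) auto
    \<comment> \<open>Since \<open>n <= K + 1\<close>, the cut-off at \<open>K\<close> loses nothing
      and the full sum of \<open>sum_em_coeff\<close> appears.\<close>
    also have "{k \<in> {..K}. k < n} = {..<n}" using n by auto
    also have "(\<Sum>k<n. of_real (em_coeff k) * (g n / fact (n - k))) =
        g n * of_real (\<Sum>k<n. em_coeff k / fact (n - k))"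
      by (simp add: sum_distrib_left mult_ac)
    also have "\<dots> = g n / fact (n - 1)" using n by (subst sum_em_coeff) auto
    finally show "(\<Sum>k\<le>K. if k < n then of_real (em_coeff k) * (g n / fact (n - k)) else 0) =
      g n / fact (n - 1)" .
  qed
  finally have main: "T 1 = (\<Sum>k\<le>K. of_real (em_coeff k) * (T k - f k z))"
    using T1 by simp
  have "em_error K f z = T 1 + e 1 - (\<Sum>k\<le>K. of_real (em_coeff k) * ((T k - f k z) + e k))"
    by (simp add: em_error_def e_def)
  also have "\<dots> = e 1 - (\<Sum>k\<le>K. of_real (em_coeff k) * e k)"
    using main by (simp add: sum.distrib ring_distribs sum_subtractf)
  finally have "norm (em_error K f z) \<le> norm (e 1) + norm (\<Sum>k\<le>K. of_real (em_coeff k) * e k)"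
    by (simp add: norm_triangle_ineq4)
  also have "norm (e 1) \<le> B" unfolding e_def by (rule tay) simp
  also have "norm (\<Sum>k\<le>K. of_real (em_coeff k) * e k) \<le> (\<Sum>k\<le>K. \<bar>em_coeff k\<bar> * B)"
    by (intro sum_norm_le) (auto simp: norm_mult e_def intro!: mult_left_mono tay)
  finally show ?thesis by (simp add: ring_distribs sum_distrib_right)
qed

section \<open>The primitive of the summand\<close>

text \<open>Two powers instead of one power of \<open>z * (z + 1)\<close>: each factor has explicit
  higher derivatives, ready for the Leibniz rule.\<close>

definition primitive :: "complex \<Rightarrow> complex \<Rightarrow> complex" where
  "primitive s z = z powr (1 - s) * (z + 1) powr (1 - s)"

abbreviation primitive_deriv :: "complex \<Rightarrow> nat \<Rightarrow> complex \<Rightarrow> complex" where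
  "primitive_deriv s n \<equiv> (deriv ^^ n) (primitive s)"

lemma Re_pos_notin_nonpos_Reals: "Re z > 0 \<Longrightarrow> z \<notin> \<real>\<^sub>\<le>\<^sub>0"
  by (auto simp: complex_nonpos_Reals_iff)

lemma holomorphic_primitive: "primitive s holomorphic_on {z. Re z > 0}"
  unfolding primitive_def[abs_def]
  by (intro holomorphic_intros) (auto simp: complex_nonpos_Reals_iff)

lemma has_field_derivative_primitive_deriv:
  assumes "Re z > 0"
  shows "(primitive_deriv s n has_field_derivative primitive_deriv s (Suc n) z) (at z)"
proof -
  have "primitive_deriv s n holomorphic_on {z. Re z > 0}"
    by (rule holomorphic_higher_deriv[OF holomorphic_primitive]) (rule open_halfspace_Re_gt)
  from holomorphic_derivI[OF this open_halfspace_Re_gt] assms show ?thesis by simp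
qed

lemma higher_deriv_powr_shift:
  assumes "Re (z + c) > 0"
  shows "(deriv ^^ n) (\<lambda>w. (w + c) powr a) z = (\<Prod>i<n. a - of_nat i) * (z + c) powr (a - of_nat n)"
  using assms
proof (induction n arbitrary: z)
  case (Suc n)
  have "open {w. Re w > - Re c}" by (rule open_halfspace_Re_gt)
  hence "eventually (\<lambda>w. w \<in> {w. Re w > - Re c}) (nhds z)"
    using Suc.prems by (intro eventually_nhds_in_open) auto
  hence "eventually (\<lambda>w. (deriv ^^ n) (\<lambda>w. (w + c) powr a) w =
      (\<Prod>i<n. a - of_nat i) * (w + c) powr (a - of_nat n)) (nhds z)"
    by eventually_elim (use Suc.IH in auto)
  hence "deriv ((deriv ^^ n) (\<lambda>w. (w + c) powr a)) z =
      deriv (\<lambda>w. (\<Prod>i<n. a - of_nat i) * (w + c) powr (a - of_nat n)) z"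
    by (rule deriv_cong_ev) simp
  also have "\<dots> = (\<Prod>i<n. a - of_nat i) * ((a - of_nat n) * (z + c) powr (a - of_nat n - 1))"
    using Suc.prems
    by (intro DERIV_imp_deriv) (auto intro!: derivative_eq_intros simp: Re_pos_notin_nonpos_Reals)
  finally show ?case by (simp add: algebra_simps)
qed simp

text \<open>The Leibniz rule. For fixed \<open>z\<close> it exhibits the derivative as a finite sum
  of functions visibly entire in \<open>s\<close>.\<close>

lemma primitive_deriv_eq:
  assumes "Re z > 0"
  shows "primitive_deriv s n z =
    (\<Sum>i = 0..n. of_nat (n choose i) * ((\<Prod>j<i. 1 - s - of_nat j) * z powr (1 - s - of_nat i)) *
      ((\<Prod>j<n - i. 1 - s - of_nat j) * (z + 1) powr (1 - s - of_nat (n - i))))"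
proof -
  have "primitive_deriv s n z = (\<Sum>i = 0..n. of_nat (n choose i) * (deriv ^^ i) (\<lambda>z. z powr (1 - s)) z *
      (deriv ^^ (n - i)) (\<lambda>z. (z + 1) powr (1 - s)) z)"
    unfolding primitive_def[abs_def]
    by (rule higher_deriv_mult[where S = "{z. Re z > 0}"])
      (auto intro!: holomorphic_intros simp: complex_nonpos_Reals_iff open_halfspace_Re_gt assms)
  also have "\<dots> = (\<Sum>i = 0..n. of_nat (n choose i) * ((\<Prod>j<i. 1 - s - of_nat j) * z powr (1 - s - of_nat i)) *
      ((\<Prod>j<n - i. 1 - s - of_nat j) * (z + 1) powr (1 - s - of_nat (n - i))))"
    using higher_deriv_powr_shift[of z 0 _ "1 - s"] higher_deriv_powr_shift[of z 1 _ "1 - s"] assms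
    by (intro sum.cong) auto
  finally show ?thesis .
qed

lemma holomorphic_primitive_deriv_param:
  assumes "Re z > 0"
  shows "(\<lambda>s. primitive_deriv s n z) holomorphic_on A"
proof -
  have "z \<noteq> 0" "z + 1 \<noteq> 0" using assms by (auto simp: complex_eq_iff)
  thus ?thesis
    unfolding primitive_deriv_eq[OF assms] by (auto intro!: holomorphic_intros)
qed

lemma primitive_deriv_1:
  assumes "Re z > 0"
  shows "primitive_deriv s 1 z = (1 - s) * ((2 * z + 1) * (z powr (- s) * (z + 1) powr (- s)))"
proof -
  have nz: "z \<noteq> 0" "z + 1 \<noteq> 0" using assms by (auto simp: complex_eq_iff)
  have e: "w powr (1 - s) = w * w powr (- s)" if "w \<noteq> 0" for w :: complex
    using that by (simp add: powr_diff powr_minus field_simps)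
  show ?thesis
    unfolding primitive_deriv_eq[OF assms] by (simp add: e nz) (simp add: algebra_simps)
qed

lemma primitive_deriv_1_of_nat:
  assumes "l \<ge> 1"
  shows "primitive_deriv s 1 (of_nat l) =
    (1 - s) * (of_nat (2 * l + 1) / of_nat (l * (l + 1)) powr s)"
proof -
  have "of_nat (l * (l + 1)) powr s = (of_nat l powr s * of_nat (l + 1) powr s :: complex)"
    using powr_times_real[of "of_nat l :: complex" "of_nat (l + 1)" s] by (simp add: algebra_simps)
  thus ?thesis using assms by (subst primitive_deriv_1) (simp_all add: powr_minus field_simps)
qed

section \<open>Growth and decay of the derivatives of the primitive\<close>

text \<open>A complex power contributes \<open>exp (Im s * Arg w)\<close> to the norm; the two
  arguments are at most \<open>pi\<close> in absolute value.\<close>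

lemma norm_primitive:
  "norm (primitive s w) \<le>
     norm w powr (1 - Re s) * norm (w + 1) powr (1 - Re s) * exp (2 * pi * \<bar>Im s\<bar>)"
proof -
  have a: "Im s * Arg z \<le> pi * \<bar>Im s\<bar>" for z
  proof -
    have "Im s * Arg z \<le> \<bar>Im s\<bar> * \<bar>Arg z\<bar>" by (metis abs_ge_self abs_mult)
    also have "\<dots> \<le> \<bar>Im s\<bar> * pi"
      using Arg_le_pi[of z] mpi_less_Arg[of z] by (intro mult_left_mono) auto
    finally show ?thesis by (simp add: mult.commute)
  qed
  have "norm (primitive s w) = norm w powr (1 - Re s) * norm (w + 1) powr (1 - Re s) *
      exp (Im s * Arg w + Im s * Arg (w + 1))"
    by (simp add: primitive_def norm_mult norm_powr_complex exp_add)
  also have "\<dots> \<le> norm w powr (1 - Re s) * norm (w + 1) powr (1 - Re s) * exp (2 * pi * \<bar>Im s\<bar>)"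
    using a[of w] a[of "w + 1"] by (intro mult_left_mono) auto
  finally show ?thesis .
qed

text \<open>Cauchy's inequality on the disc of radius \<open>x / 2\<close> about \<open>x\<close>,
  which stays in the right half plane. The hypothesis speaks of norms alone, to match
  \<open>norm_primitive\<close>.\<close>

lemma primitive_deriv_Cauchy:
  assumes x: "x > 0"
    and B: "\<And>w. \<lbrakk>x / 2 \<le> norm w; x / 2 \<le> norm (w + 1); norm w \<le> 3 / 2 * x\<rbrakk> \<Longrightarrow> norm (primitive s w) \<le> B"
  shows "norm (primitive_deriv s n (of_real x)) \<le> fact n * B / (x / 2) ^ n"
proof (rule Cauchy_inequality)
  have "Re w > 0" if "dist (of_real x) w \<le> x / 2" for w
  proof -
    have "\<bar>Re (of_real x - w)\<bar> \<le> x / 2"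
      using abs_Re_le_cmod[of "of_real x - w"] that by (simp add: dist_norm)
    from abs_le_D1[OF this] show ?thesis using x by simp
  qed
  hence sub: "cball (of_real x) (x / 2) \<subseteq> {z. Re z > 0}" by auto
  show "primitive s holomorphic_on ball (of_real x) (x / 2)"
    by (rule holomorphic_on_subset[OF holomorphic_primitive]) (use sub ball_subset_cball in blast)
  show "continuous_on (cball (of_real x) (x / 2)) (primitive s)"
    using sub holomorphic_primitive continuous_on_subset holomorphic_on_imp_continuous_on by blast
  show "norm (primitive s w) \<le> B" if "norm (of_real x - w) = x / 2" for w
  proof (rule B)
    have *: "\<bar>Re (of_real x - w)\<bar> \<le> x / 2" using abs_Re_le_cmod[of "of_real x - w"] that by simp
    hence *: "x / 2 \<le> Re w" using abs_le_D1[OF *] by simp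
    thus "x / 2 \<le> norm w" using complex_Re_le_cmod[of w] by simp
    show "x / 2 \<le> norm (w + 1)" using * complex_Re_le_cmod[of "w + 1"] by simp
    show "norm w \<le> 3 / 2 * x"
      using norm_triangle_ineq4[of "of_real x" "of_real x - w"] that x by simp
  qed
qed (use x in auto)

text \<open>Each of the two powers is at most \<open>(2 * x) ^ (A + 1)\<close>, and each of the
  \<open>2 * A + 4\<close> derivatives gains a factor of order \<open>1 / x\<close>. What remains is
  \<open>1 / x ^ 2\<close>, which is summable: this dictates the order
  \<open>K = 2 * A + 2\<close>.\<close>

lemma primitive_deriv_bound:
  assumes x: "x \<ge> 2" and s: "Re s > - real A"
  shows "norm (primitive_deriv s (2 * A + 2 + 2) (of_real x)) \<le>
    fact (2 * A + 2 + 2) * 4 ^ (2 * A + 2 + 2) * exp (2 * pi * \<bar>Im s\<bar>) / x ^ 2"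
proof -
  define E where "E = exp (2 * pi * \<bar>Im s\<bar>)"
  have "norm (primitive_deriv s (2 * A + 4) (of_real x)) \<le>
      fact (2 * A + 4) * ((2 * x) ^ (A + 1) * (2 * x) ^ (A + 1) * E) / (x / 2) ^ (2 * A + 4)"
  proof (rule primitive_deriv_Cauchy)
    fix w :: complex
    assume w: "x / 2 \<le> norm w" "x / 2 \<le> norm (w + 1)" "norm w \<le> 3 / 2 * x"
    have p: "norm u powr (1 - Re s) \<le> (2 * x) ^ (A + 1)" if "x / 2 \<le> norm u" "norm u \<le> 2 * x" for u :: complex
    proof -
      \<comment> \<open>The exponent may be enlarged because
        \<open>norm u >= x / 2 >= 1\<close>.\<close>
      have "norm u powr (1 - Re s) \<le> norm u powr (of_nat (A + 1))"
        using s x that by (intro powr_mono) auto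
      also have "\<dots> = norm u ^ (A + 1)" using that x by (subst powr_realpow) auto
      also have "\<dots> \<le> (2 * x) ^ (A + 1)" using that by (intro power_mono) auto
      finally show ?thesis .
    qed
    have "norm (w + 1) \<le> 2 * x" using norm_triangle_ineq[of w 1] w x by simp
    hence "norm w powr (1 - Re s) * norm (w + 1) powr (1 - Re s) \<le> (2 * x) ^ (A + 1) * (2 * x) ^ (A + 1)"
      using w x by (intro mult_mono p) auto
    hence "norm w powr (1 - Re s) * norm (w + 1) powr (1 - Re s) * E \<le> (2 * x) ^ (A + 1) * (2 * x) ^ (A + 1) * E"
      by (intro mult_right_mono) (auto simp: E_def)
    with norm_primitive[of s w] show "norm (primitive s w) \<le> (2 * x) ^ (A + 1) * (2 * x) ^ (A + 1) * E"
      unfolding E_def by linarith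
  qed (use x in auto)
  also have "(2 * x) ^ (A + 1) * (2 * x) ^ (A + 1) = (2 * x) ^ (2 * A + 2)"
  proof -
    have "2 * A + 2 = (A + 1) + (A + 1)" by simp
    thus ?thesis by (simp only: power_add)
  qed
  also have "fact (2 * A + 4) * ((2 * x) ^ (2 * A + 2) * E) / (x / 2) ^ (2 * A + 4) =
      fact (2 * A + 4) * (4 ^ (2 * A + 3)) * E / x ^ 2"
  proof -
    have 1: "(2 * x) ^ (2 * A + 2) / (x / 2) ^ (2 * A + 2) = 4 ^ (2 * A + 2)"
      using x by (subst power_divide[symmetric]) simp
    have eq: "(x / 2) ^ (2 * A + 4) = (x / 2) ^ (2 * A + 2) * (x / 2) ^ 2"
    proof -
      have "2 * A + 4 = (2 * A + 2) + 2" by simp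
      thus ?thesis by (simp only: power_add)
    qed
    have "fact (2 * A + 4) * ((2 * x) ^ (2 * A + 2) * E) / (x / 2) ^ (2 * A + 4) =
        fact (2 * A + 4) * E * ((2 * x) ^ (2 * A + 2) / (x / 2) ^ (2 * A + 2)) / (x / 2) ^ 2"
      unfolding eq by (simp only: times_divide_eq_left times_divide_eq_right divide_divide_eq_left mult_ac)
    also have "\<dots> = fact (2 * A + 4) * (4 ^ (2 * A + 3)) * E / x ^ 2"
    proof -
      have "2 * A + 3 = Suc (2 * A + 2)" by simp
      hence 2: "(4::real) ^ (2 * A + 3) = 4 * 4 ^ (2 * A + 2)" by (simp only: power_Suc)
      have 3: "(x / 2) ^ 2 = x ^ 2 / 4" by (simp add: power_divide)
      have "c * E * p / (y / 4) = c * (4 * p) * E / y" for c p y :: real by simp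
      thus ?thesis unfolding 1 2 3 .
    qed
    finally show ?thesis .
  qed
  also have "\<dots> \<le> fact (2 * A + 4) * 4 ^ (2 * A + 4) * E / x ^ 2"
    by (intro divide_right_mono mult_right_mono mult_left_mono power_increasing) (auto simp: E_def)
  also have "2 * A + 4 = 2 * A + 2 + 2" by simp
  finally show ?thesis unfolding E_def .
qed

text \<open>For \<open>Re s > 1\<close> the exponents \<open>1 - Re s\<close> are negative, so lower
  bounds on the disc give decay. This removes the boundary terms at infinity.\<close>

lemma primitive_deriv_tendsto_0:
  assumes s: "Re s > 1"
  shows "(\<lambda>l. primitive_deriv s n (of_nat (l + 1))) \<longlonglongrightarrow> 0"
proof (rule Lim_null_comparison)
  define E where "E = exp (2 * pi * \<bar>Im s\<bar>)"
  define g where "g x = fact n * ((x / 2) powr (1 - Re s) * (x / 2) powr (1 - Re s) * E) * inverse (x / 2) ^ n" for x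
  have "norm (primitive_deriv s n (of_real x)) \<le> g x" if x: "x > 0" for x
    unfolding g_def power_inverse divide_inverse[of _ "(x / 2) ^ n", symmetric]
  proof (rule primitive_deriv_Cauchy[OF x])
    fix w :: complex
    assume w: "x / 2 \<le> norm w" "x / 2 \<le> norm (w + 1)" "norm w \<le> 3 / 2 * x"
    have "norm w powr (1 - Re s) * norm (w + 1) powr (1 - Re s) \<le> (x / 2) powr (1 - Re s) * (x / 2) powr (1 - Re s)"
      using w x s by (intro mult_mono powr_mono2') auto
    hence "norm w powr (1 - Re s) * norm (w + 1) powr (1 - Re s) * E \<le> (x / 2) powr (1 - Re s) * (x / 2) powr (1 - Re s) * E"
      by (intro mult_right_mono) (auto simp: E_def)
    with norm_primitive[of s w] show "norm (primitive s w) \<le> (x / 2) powr (1 - Re s) * (x / 2) powr (1 - Re s) * E"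
      unfolding E_def by linarith
  qed
  from this[of "real (_ + 1)"] show "\<forall>\<^sub>F l in sequentially. norm (primitive_deriv s n (of_nat (l + 1))) \<le> g (real (l + 1))"
    by (intro always_eventually) auto
  have "(g \<longlongrightarrow> 0) at_top"
  proof -
    have half: "filterlim (\<lambda>x::real. x / 2) at_top at_top"
      unfolding filterlim_at_top eventually_at_top_linorder
    proof
      fix Z :: real
      show "\<exists>N. \<forall>x\<ge>N. Z \<le> x / 2" by (rule exI[of _ "2 * Z"]) auto
    qed
    have 1: "((\<lambda>x. (x / 2) powr (1 - Re s)) \<longlongrightarrow> 0) at_top"
      using s by (intro tendsto_neg_powr half) auto
    \<comment> \<open>For \<open>n = 0\<close> this limit is 1; the two powers from \<open>1\<close>
      still force the product to 0.\<close>
    have 2: "((\<lambda>x::real. inverse (x / 2) ^ n) \<longlongrightarrow> 0 ^ n) at_top"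
      by (intro tendsto_power tendsto_inverse_0_at_top half)
    have "((\<lambda>x. fact n * ((x / 2) powr (1 - Re s) * (x / 2) powr (1 - Re s) * E) * inverse (x / 2) ^ n)
        \<longlongrightarrow> fact n * (0 * 0 * E) * 0 ^ n) at_top"
      by (intro tendsto_intros 1 2)
    thus ?thesis unfolding g_def by (simp only: mult_zero_left mult_zero_right)
  qed
  moreover have "filterlim (\<lambda>l::nat. real (l + 1)) at_top sequentially"
    by (rule filterlim_compose[OF filterlim_real_sequentially filterlim_subseq])
      (simp add: strict_mono_def)
  ultimately show "(\<lambda>l. g (real (l + 1))) \<longlonglongrightarrow> 0" by (rule filterlim_compose)
qed

section \<open>Analytic continuation\<close>

text \<open>The index \<open>A\<close> refers to the half plane \<open>Re s > -A\<close>, where the series of errors converges.\<close>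

definition em_zeta :: "nat \<Rightarrow> complex \<Rightarrow> complex" where
  "em_zeta A s = primitive_deriv s 1 1
     - (\<Sum>k\<le>2 * A + 2. of_real (em_coeff k) * primitive_deriv s k 1)
     + (\<Sum>l. em_error (2 * A + 2) (primitive_deriv s) (of_nat (l + 1)))"

text \<open>\<open>em_error_bound\<close> on the segment from \<open>l\<close> to
  \<open>l + 1\<close>; \<open>l >= 2\<close> brings all its points into the range of
  \<open>primitive_deriv_bound\<close>.\<close>

lemma norm_em_error_primitive:
  assumes l: "l \<ge> 2" and s: "Re s > - real A"
  shows "norm (em_error (2 * A + 2) (primitive_deriv s) (of_nat l)) \<le>
    (1 + (\<Sum>k\<le>2 * A + 2. \<bar>em_coeff k\<bar>)) *
      (fact (2 * A + 2 + 2) * 4 ^ (2 * A + 2 + 2) * exp (2 * pi * \<bar>Im s\<bar>) / real l ^ 2)"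
proof (rule em_error_bound)
  define S :: "complex set" where "S = closed_segment (of_nat l) (of_nat l + 1)"
  have S: "\<exists>t. w = of_real t \<and> t \<ge> real l" if "w \<in> S" for w
  proof -
    from that obtain u where u: "u \<ge> 0" "w = (1 - u) *\<^sub>R of_nat l + u *\<^sub>R (of_nat l + 1)"
      unfolding S_def closed_segment_def by auto
    hence "w = of_real (real l + u)" by (simp add: scaleR_conv_of_real algebra_simps)
    with u show ?thesis by (intro exI[of _ "real l + u"]) auto
  qed
  show "convex S" "of_nat l \<in> S" "of_nat l + 1 \<in> S" by (auto simp: S_def)
  show "(primitive_deriv s i has_field_derivative primitive_deriv s (Suc i) x) (at x within S)"
    if "x \<in> S" for i x
    using S[OF that] l
    by (intro has_field_derivative_at_within[OF has_field_derivative_primitive_deriv]) auto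
  show "norm (primitive_deriv s (2 * A + 2 + 2) x) \<le>
      fact (2 * A + 2 + 2) * 4 ^ (2 * A + 2 + 2) * exp (2 * pi * \<bar>Im s\<bar>) / real l ^ 2"
    if "x \<in> S" for x
  proof -
    obtain t where t: "x = of_real t" "t \<ge> real l" using S[OF \<open>x \<in> S\<close>] by blast
    have "norm (primitive_deriv s (2 * A + 2 + 2) x) \<le>
        fact (2 * A + 2 + 2) * 4 ^ (2 * A + 2 + 2) * exp (2 * pi * \<bar>Im s\<bar>) / t ^ 2"
      unfolding t by (rule primitive_deriv_bound) (use t l s in auto)
    also have "\<dots> \<le> fact (2 * A + 2 + 2) * 4 ^ (2 * A + 2 + 2) * exp (2 * pi * \<bar>Im s\<bar>) / real l ^ 2"
      using t l by (intro divide_left_mono power_mono mult_pos_pos) auto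
    finally show ?thesis .
  qed
qed

text \<open>The error bound is uniform in \<open>Re s\<close> but grows like
  \<open>exp (2 * pi * \<bar>Im s\<bar>)\<close>, hence the restriction on the imaginary
  part.\<close>

lemma uniform_limit_em_error:
  "uniform_limit {s. Re s > - real A \<and> \<bar>Im s\<bar> \<le> R}
     (\<lambda>n s. \<Sum>l<n. em_error (2 * A + 2) (primitive_deriv s) (of_nat (l + 1)))
     (\<lambda>s. \<Sum>l. em_error (2 * A + 2) (primitive_deriv s) (of_nat (l + 1))) sequentially"
proof (rule Weierstrass_m_test_ev)
  define C where "C = (1 + (\<Sum>k\<le>2 * A + 2. \<bar>em_coeff k\<bar>)) *
    (fact (2 * A + 2 + 2) * 4 ^ (2 * A + 2 + 2) * exp (2 * pi * R))"
  \<comment> \<open>Index 0 belongs to \<open>z = 1\<close>, which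
    \<open>norm_em_error_primitive\<close> excludes; the M-test only asks for a bound
    eventually.\<close>
  have "norm (em_error (2 * A + 2) (primitive_deriv s) (of_nat (l + 1))) \<le> C * inverse (real (Suc l) ^ 2)"
    if "l \<ge> 1" "s \<in> {s. Re s > - real A \<and> \<bar>Im s\<bar> \<le> R}" for l s
  proof -
    have "norm (em_error (2 * A + 2) (primitive_deriv s) (of_nat (l + 1))) \<le>
      (1 + (\<Sum>k\<le>2 * A + 2. \<bar>em_coeff k\<bar>)) *
      (fact (2 * A + 2 + 2) * 4 ^ (2 * A + 2 + 2) * exp (2 * pi * \<bar>Im s\<bar>) / real (l + 1) ^ 2)"
      by (rule norm_em_error_primitive) (use that in auto)
    also have "\<dots> \<le> (1 + (\<Sum>k\<le>2 * A + 2. \<bar>em_coeff k\<bar>)) *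
      (fact (2 * A + 2 + 2) * 4 ^ (2 * A + 2 + 2) * exp (2 * pi * R) / real (l + 1) ^ 2)"
      using that by (intro mult_left_mono divide_right_mono) (auto intro!: add_nonneg_nonneg sum_nonneg)
    finally show ?thesis by (simp add: C_def divide_inverse mult.assoc)
  qed
  thus "\<forall>\<^sub>F l in sequentially. \<forall>s\<in>{s. Re s > - real A \<and> \<bar>Im s\<bar> \<le> R}.
      norm (em_error (2 * A + 2) (primitive_deriv s) (of_nat (l + 1))) \<le> C * inverse (real (Suc l) ^ 2)"
    by (intro eventually_sequentiallyI[of 1]) blast
  have "summable (\<lambda>n. inverse (real n ^ 2))"
    by (rule inverse_power_summable) simp
  hence "summable (\<lambda>n. inverse (real (Suc n) ^ 2))"
    by (subst summable_Suc_iff)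
  thus "summable (\<lambda>l. C * inverse (real (Suc l) ^ 2))"
    by (rule summable_mult)
qed

text \<open>A locally uniform limit of holomorphic partial sums: every closed disc in the half plane
  has bounded imaginary part.\<close>

lemma holomorphic_em_zeta: "em_zeta A holomorphic_on {s. Re s > - real A}"
proof -
  have "(\<lambda>s. \<Sum>l. em_error (2 * A + 2) (primitive_deriv s) (of_nat (l + 1))) holomorphic_on {s. Re s > - real A}"
  proof (rule holomorphic_uniform_sequence)
    show op: "open {s. Re s > - real A}" by (rule open_halfspace_Re_gt)
    show "(\<lambda>s. \<Sum>l<n. em_error (2 * A + 2) (primitive_deriv s) (of_nat (l + 1))) holomorphic_on {s. Re s > - real A}" for n
      unfolding em_error_def
      by (intro holomorphic_intros holomorphic_primitive_deriv_param) auto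
    fix s assume "s \<in> {s. Re s > - real A}"
    with op obtain d where d: "d > 0" "cball s d \<subseteq> {s. Re s > - real A}"
      using open_contains_cball_eq by blast
    have "\<bar>Im w\<bar> \<le> norm s + d" if "w \<in> cball s d" for w
    proof -
      have "norm w \<le> norm s + norm (s - w)" using norm_triangle_ineq4[of s "s - w"] by simp
      thus ?thesis using that abs_Im_le_cmod[of w] by (simp add: dist_norm)
    qed
    with d have "cball s d \<subseteq> {w. Re w > - real A \<and> \<bar>Im w\<bar> \<le> norm s + d}" by blast
    with d uniform_limit_on_subset[OF uniform_limit_em_error this]
    show "\<exists>d>0. cball s d \<subseteq> {s. Re s > - real A} \<and> uniform_limit (cball s d)
        (\<lambda>n s. \<Sum>l<n. em_error (2 * A + 2) (primitive_deriv s) (of_nat (l + 1)))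
        (\<lambda>s. \<Sum>l. em_error (2 * A + 2) (primitive_deriv s) (of_nat (l + 1))) sequentially"
      by blast
  qed
  thus ?thesis
    unfolding em_zeta_def[abs_def]
    by (intro holomorphic_intros holomorphic_primitive_deriv_param) auto
qed

text \<open>Error plus telescoping difference gives back the derivative at the right end point, and
  the boundary terms \<open>T\<close> tend to 0.\<close>

lemma em_zeta_sums:
  assumes s: "Re s > 1"
  shows "(\<lambda>l. primitive_deriv s 1 (of_nat (Suc l))) sums em_zeta A s"
proof -
  define e where "e l = em_error (2 * A + 2) (primitive_deriv s) (of_nat (l + 1))" for l
  define T where "T l = (\<Sum>k\<le>2 * A + 2. of_real (em_coeff k) * primitive_deriv s k (of_nat (l + 1)))" for l
  have "(\<lambda>n. \<Sum>l<n. e l) \<longlonglongrightarrow> (\<Sum>l. e l)"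
    unfolding e_def
    by (rule tendsto_uniform_limitI[OF uniform_limit_em_error[of A "\<bar>Im s\<bar>"]]) (use s in auto)
  hence "e sums (\<Sum>l. e l)" by (simp add: sums_def)
  moreover have "T \<longlonglongrightarrow> (\<Sum>k\<le>2 * A + 2. of_real (em_coeff k) * 0)"
    unfolding T_def by (intro tendsto_intros primitive_deriv_tendsto_0 s)
  hence "(\<lambda>l. T (Suc l) - T l) sums (0 - T 0)"
    by (intro telescope_sums) simp
  ultimately have "(\<lambda>l. e l + (T (Suc l) - T l)) sums ((\<Sum>l. e l) + (0 - T 0))"
    by (rule sums_add)
  moreover have "e l + (T (Suc l) - T l) = primitive_deriv s 1 (of_nat (Suc (Suc l)))" for l
    by (simp add: e_def T_def em_error_def sum_subtractf right_diff_distrib add_ac)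
  ultimately have "(\<lambda>l. primitive_deriv s 1 (of_nat (Suc (Suc l)))) sums ((\<Sum>l. e l) + (0 - T 0))"
    by simp
  \<comment> \<open>Right end points start at 2, so the derivative at 1 is added separately.\<close>
  from sums_Suc[OF this] show ?thesis
    by (simp add: em_zeta_def e_def T_def algebra_simps)
qed

text \<open>Both sides are the sum of the same series for \<open>Re s > 1\<close>; the identity
  theorem carries equality to the connected half plane.\<close>

lemma em_zeta_mono:
  assumes "A \<le> B" "Re s > - real A"
  shows "em_zeta A s = em_zeta B s"
proof (rule analytic_continuation_open[where f = "em_zeta A" and g = "em_zeta B"
    and s = "{s. Re s > 1}" and s' = "{s. Re s > - real A}"])
  show "em_zeta B holomorphic_on {s. Re s > - real A}"
    using assms by (intro holomorphic_on_subset[OF holomorphic_em_zeta]) auto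
  show "em_zeta A z = em_zeta B z" if "z \<in> {s. Re s > 1}" for z
    using that em_zeta_sums sums_unique2 by blast
  show "{s. Re s > 1} \<noteq> {}" by (auto intro!: exI[of _ 2])
  show "connected {s. Re s > - real A}"
    by (intro convex_connected convex_halfspace_Re_gt)
qed (use assms in \<open>auto intro: holomorphic_em_zeta open_halfspace_Re_gt\<close>)

text \<open>The entire function \<open>(1 - s)\<close> times zeta. The chosen index is one natural
  \<open>A\<close> with \<open>Re s > -A\<close>; by \<open>em_zeta_mono\<close> any other gives the
  same value.\<close>

definition entire_zeta :: "complex \<Rightarrow> complex" where
  "entire_zeta s = em_zeta (nat \<lceil>- Re s\<rceil> + 1) s"

lemma entire_zeta_eq:
  assumes "Re s > - real A"
  shows "entire_zeta s = em_zeta A s"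
proof -
  define B where "B = nat \<lceil>- Re s\<rceil> + 1"
  have "Re s > - real B" unfolding B_def by linarith
  hence "em_zeta B s = em_zeta A s"
    using em_zeta_mono[of A B s] em_zeta_mono[of B A s] assms by (metis nle_le)
  thus ?thesis
    unfolding entire_zeta_def B_def .
qed

lemma holomorphic_entire_zeta: "entire_zeta holomorphic_on UNIV"
  unfolding holomorphic_on_def
proof (intro ballI)
  fix s
  define A where "A = nat \<lceil>- Re s\<rceil> + 1"
  have s: "Re s > - real A" unfolding A_def by linarith
  have "entire_zeta holomorphic_on {s. Re s > - real A}"
    by (rule holomorphic_transform[OF holomorphic_em_zeta]) (simp add: entire_zeta_eq)
  with s show "entire_zeta field_differentiable at s within UNIV"
    by (auto dest!: holomorphic_on_imp_differentiable_at simp: open_halfspace_Re_gt)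
qed

section \<open>Identification with the zeta function\<close>

lemma fubini_study_series_summable:
  assumes "Re s > 1"
  shows "summable (\<lambda>l. norm (of_nat (2 * l + 1) / of_nat (l * (l + 1)) powr s :: complex))"
proof (rule summable_comparison_test_ev)
  show "summable (\<lambda>l. 3 * real l powr (1 - 2 * Re s))"
    using assms by (intro summable_mult) (simp add: summable_real_powr_iff)
  have "norm (of_nat (2 * l + 1) / of_nat (l * (l + 1)) powr s :: complex) \<le> 3 * real l powr (1 - 2 * Re s)"
    if l: "l \<ge> 1" for l
  proof -
    have "norm (of_nat (l * (l + 1)) powr s :: complex) = real (l * (l + 1)) powr Re s"
      using norm_powr_real_powr[of "of_nat (l * (l + 1))" s] by simp
    hence "norm (of_nat (2 * l + 1) / of_nat (l * (l + 1)) powr s :: complex) =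
        real (2 * l + 1) / real (l * (l + 1)) powr Re s"
      by (simp only: norm_divide norm_of_nat)
    also have "\<dots> \<le> 3 * real l / (real l * real l) powr Re s"
      using l assms by (intro frac_le powr_mono2) (auto simp: algebra_simps)
    also have "(real l * real l) powr Re s = real l powr (2 * Re s)"
      by (simp only: powr_mult of_nat_0_le_iff mult_2 powr_add)
    also have "3 * real l / real l powr (2 * Re s) = 3 * real l powr (1 - 2 * Re s)"
      using l by (simp add: powr_diff)
    finally show ?thesis .
  qed
  thus "\<forall>\<^sub>F l in sequentially. norm (norm (of_nat (2 * l + 1) / of_nat (l * (l + 1)) powr s :: complex)) \<le>
      3 * real l powr (1 - 2 * Re s)"
    by (intro eventually_sequentiallyI[of 1]) simp
qed

text \<open>Euler--Maclaurin summation gives the ordered sum; absolute summability upgrades it to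
  \<open>has_sum\<close>.\<close>

lemma fubini_study_series_has_sum:
  assumes s: "Re s > 1"
  shows "((\<lambda>l::nat. of_nat (2 * l + 1) / of_nat (l * (l + 1)) powr s) has_sum
    (entire_zeta s / (1 - s))) {1..}"
proof -
  define a :: "nat \<Rightarrow> complex" where "a l = of_nat (2 * l + 1) / of_nat (l * (l + 1)) powr s" for l
  have s1: "1 - s \<noteq> 0" using s by auto
  have "(\<lambda>l. primitive_deriv s 1 (of_nat (Suc l)) / (1 - s)) sums (em_zeta 0 s / (1 - s))"
    by (intro sums_divide em_zeta_sums s)
  moreover have "primitive_deriv s 1 (of_nat (Suc l)) / (1 - s) = a (Suc l)" for l
    unfolding a_def by (subst primitive_deriv_1_of_nat) (use s1 in auto)
  ultimately have "(\<lambda>l. a (Suc l)) sums (entire_zeta s / (1 - s))"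
    using s by (simp add: entire_zeta_eq[of 0])
  moreover have "summable (\<lambda>l. norm (a (Suc l)))"
    using fubini_study_series_summable[OF s] unfolding a_def by (subst summable_Suc_iff)
  ultimately have "((\<lambda>l. a (Suc l)) has_sum (entire_zeta s / (1 - s))) UNIV"
    by (intro norm_summable_imp_has_sum)
  hence "((a \<circ> Suc) has_sum (entire_zeta s / (1 - s))) UNIV" by (simp add: o_def)
  hence "(a has_sum (entire_zeta s / (1 - s))) (Suc ` UNIV)"
    by (subst has_sum_reindex) auto
  also have "Suc ` UNIV = {1..}" by (auto simp: image_iff Suc_le_eq gr0_conv_Suc)
  finally show ?thesis unfolding a_def .
qed

lemma analytic_zeta_quotient:
  assumes "s \<noteq> 1"
  shows "(\<lambda>s. entire_zeta s / (1 - s)) analytic_on {s}"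
proof -
  have "entire_zeta analytic_on {s}"
    using holomorphic_entire_zeta analytic_on_open analytic_on_subset by blast
  thus ?thesis using assms by (auto intro!: analytic_intros)
qed

text \<open>\<open>remove_sings\<close> supplies the normalisation at \<open>s = 1\<close> without
  deciding whether the quotient has a pole there.\<close>

lemma is_fubini_study_zeta_quotient:
  "is_fubini_study_zeta (remove_sings (\<lambda>s. entire_zeta s / (1 - s)))"
  unfolding is_fubini_study_zeta_def
proof (intro conjI allI impI)
  have "entire_zeta meromorphic_on UNIV"
    using holomorphic_entire_zeta analytic_on_open analytic_on_imp_meromorphic_on by blast
  hence "(\<lambda>s. entire_zeta s / (1 - s)) meromorphic_on UNIV"
    by (auto intro!: meromorphic_intros)
  thus "remove_sings (\<lambda>s. entire_zeta s / (1 - s)) nicely_meromorphic_on UNIV"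
    by (rule remove_sings_nicely_meromorphic)
  fix s :: complex assume s: "Re s > 1"
  hence "remove_sings (\<lambda>s. entire_zeta s / (1 - s)) s = entire_zeta s / (1 - s)"
    by (intro remove_sings_at_analytic analytic_zeta_quotient) auto
  thus "((\<lambda>l::nat. of_nat (2 * l + 1) / of_nat (l * (l + 1)) powr s) has_sum
      remove_sings (\<lambda>s. entire_zeta s / (1 - s)) s) {1..}"
    using fubini_study_series_has_sum[OF s] by simp
qed

lemma fubini_study_zeta_eq:
  "fubini_study_zeta = remove_sings (\<lambda>s. entire_zeta s / (1 - s))"
  unfolding fubini_study_zeta_def
  using is_fubini_study_zeta_quotient is_fubini_study_zeta_unique by (blast intro: the_equality)

section \<open>Values at the non-positive integers\<close>

text \<open>The primitive at \<open>s = -m\<close>, in a form that also has derivatives at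
  \<open>z = 0\<close>, on the boundary of the half plane used so far.\<close>

definition primitive_poly :: "nat \<Rightarrow> complex poly" where
  "primitive_poly m = monom 1 (m + 1) * [:1, 1:] ^ (m + 1)"

lemma higher_pderiv_primitive_poly_eq_0:
  assumes "n > 2 * m + 2"
  shows "(pderiv ^^ n) (primitive_poly m) = 0"
proof (rule poly_eqI)
  fix i
  have "degree (primitive_poly m) \<le> (m + 1) + 1 * (m + 1)"
    unfolding primitive_poly_def
    by (intro order.trans[OF degree_mult_le] add_mono degree_monom_le
      order.trans[OF degree_power_le]) simp
  hence "coeff (primitive_poly m) (i + n) = 0" using assms by (intro coeff_eq_0) auto
  thus "coeff ((pderiv ^^ n) (primitive_poly m)) i = coeff 0 i"
    by (simp add: coeff_higher_pderiv)
qed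

text \<open>Taylor coefficients of \<open>X^(m+1) (1 + X)^(m+1)\<close> at 0; the symmetry of
  binomial coefficients turns \<open>k - (m + 1)\<close> into \<open>2 * m + 2 - k\<close>.\<close>

lemma higher_pderiv_primitive_poly_0:
  assumes "k \<le> 2 * m + 2"
  shows "poly ((pderiv ^^ k) (primitive_poly m)) 0 =
    (if k < m + 1 then 0 else fact k * of_nat ((m + 1) choose (2 * m + 2 - k)))"
proof -
  have "poly ((pderiv ^^ k) (primitive_poly m)) 0 = fact k * coeff (primitive_poly m) k"
    by (simp add: poly_0_coeff_0 coeff_higher_pderiv pochhammer_fact)
  also have "coeff (primitive_poly m) k =
      (if k < m + 1 then 0 else of_nat ((m + 1) choose (k - (m + 1))))"
    using assms unfolding primitive_poly_def coeff_monom_mult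
    by (auto simp: coeff_linear_poly_power simp del: power_Suc)
  also have "(if k < m + 1 then 0 else of_nat ((m + 1) choose (k - (m + 1)))) =
      (if k < m + 1 then 0 else of_nat ((m + 1) choose (2 * m + 2 - k)) :: complex)"
  proof -
    have "(m + 1) choose (k - (m + 1)) = (m + 1) choose (2 * m + 2 - k)" if "k \<ge> m + 1"
    proof -
      have "(m + 1) - (k - (m + 1)) = 2 * m + 2 - k" using that assms by simp
      thus ?thesis using binomial_symmetric[of "k - (m + 1)" "m + 1"] that assms by simp
    qed
    thus ?thesis by auto
  qed
  finally show ?thesis by (simp add: if_distrib cong: if_cong)
qed

lemma primitive_deriv_neg_of_nat:
  assumes "Re z > 0"
  shows "primitive_deriv (- of_nat m) n z = poly ((pderiv ^^ n) (primitive_poly m)) z"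
  using assms
proof (induction n arbitrary: z)
  case 0
  have nz: "z \<noteq> 0" "z + 1 \<noteq> 0" using 0 by (auto simp: complex_eq_iff)
  have "w powr (1 - (- of_nat m)) = w ^ (m + 1)" if "w \<noteq> 0" for w :: complex
    using powr_nat'[of w "m + 1"] that by (simp add: add_ac)
  with nz show ?case
    by (simp add: primitive_def primitive_poly_def poly_monom algebra_simps)
next
  case (Suc n)
  have "eventually (\<lambda>w. w \<in> {w. Re w > 0}) (nhds z)"
    using Suc.prems by (intro eventually_nhds_in_open open_halfspace_Re_gt) auto
  hence "eventually (\<lambda>w. primitive_deriv (- of_nat m) n w = poly ((pderiv ^^ n) (primitive_poly m)) w) (nhds z)"
    by eventually_elim (use Suc.IH in auto)
  hence "deriv (primitive_deriv (- of_nat m) n) z = deriv (poly ((pderiv ^^ n) (primitive_poly m))) z"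
    by (rule deriv_cong_ev) simp
  also have "\<dots> = poly ((pderiv ^^ Suc n) (primitive_poly m)) z"
    by (simp add: DERIV_imp_deriv poly_DERIV)
  finally show ?case by simp
qed

text \<open>The derivative of order \<open>K + 2\<close> vanishes for degree reasons, so
  \<open>em_error_bound\<close> holds with \<open>B = 0\<close>, on the whole plane.\<close>

lemma em_error_primitive_poly:
  "em_error (2 * (m + 1) + 2) (\<lambda>n. poly ((pderiv ^^ n) (primitive_poly m))) z = 0"
proof -
  have "norm (em_error (2 * (m + 1) + 2) (\<lambda>n. poly ((pderiv ^^ n) (primitive_poly m))) z) \<le>
    (1 + (\<Sum>k\<le>2 * (m + 1) + 2. \<bar>em_coeff k\<bar>)) * 0"
  proof (rule em_error_bound[where S = UNIV])
    show "(poly ((pderiv ^^ i) (primitive_poly m)) has_field_derivative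
        poly ((pderiv ^^ Suc i) (primitive_poly m)) x) (at x within UNIV)" for i x
      by (simp add: poly_DERIV)
    show "norm (poly ((pderiv ^^ (2 * (m + 1) + 2 + 2)) (primitive_poly m)) x) \<le> 0" for x
      by (subst higher_pderiv_primitive_poly_eq_0) auto
  qed auto
  thus ?thesis by simp
qed

lemma entire_zeta_neg_of_nat:
  "entire_zeta (- of_nat m) = - of_real (\<Sum>k = m + 1..2 * m + 2.
     (- 1) ^ k * real ((m + 1) choose (2 * m + 2 - k)) * bernoulli_number k)"
proof -
  define K where "K = 2 * (m + 1) + 2"
  define Q where "Q n = poly ((pderiv ^^ n) (primitive_poly m))" for n
  have err: "em_error K Q z = 0" for z
    using em_error_primitive_poly unfolding K_def Q_def[abs_def] .
  have Q: "primitive_deriv (- of_nat m) k z = Q k z" if "Re z > 0" for k z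
    unfolding Q_def using that by (rule primitive_deriv_neg_of_nat)
  have "em_error K (primitive_deriv (- of_nat m)) (of_nat (l + 1)) = em_error K Q (of_nat (l + 1))" for l
    unfolding em_error_def by (subst (1 2 3) Q) auto
  hence err': "em_error K (primitive_deriv (- of_nat m)) (of_nat (l + 1)) = 0" for l
    by (simp only: err)
  \<comment> \<open>Index \<open>m + 1\<close> rather than \<open>m\<close>, because the half plane
    \<open>Re s > -A\<close> is open.\<close>
  have "entire_zeta (- of_nat m) = em_zeta (m + 1) (- of_nat m)"
    by (rule entire_zeta_eq) simp
  also have "\<dots> = Q 1 1 - (\<Sum>k\<le>K. of_real (em_coeff k) * Q k 1)"
    unfolding em_zeta_def K_def[symmetric] err' by (subst (1 2) Q) auto
  \<comment> \<open>The vanishing error at \<open>z = 0\<close> expresses \<open>Q 1 1\<close>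
    through the differences \<open>Q k 1 - Q k 0\<close>, so only values at 0 remain.\<close>
  also have "\<dots> = - (\<Sum>k\<le>K. of_real (em_coeff k) * Q k 0)"
    using err[of 0] by (simp add: em_error_def right_diff_distrib sum_subtractf)
  also have "(\<Sum>k\<le>K. of_real (em_coeff k) * Q k 0) =
      (\<Sum>k = m + 1..2 * m + 2. of_real (em_coeff k) * Q k 0)"
  proof (rule sum.mono_neutral_right)
    show "\<forall>k\<in>{..K} - {m + 1..2 * m + 2}. of_real (em_coeff k) * Q k 0 = 0"
    proof
      fix k assume "k \<in> {..K} - {m + 1..2 * m + 2}"
      hence "k < m + 1 \<or> k > 2 * m + 2" by auto
      hence "Q k 0 = 0"
        unfolding Q_def
      proof
        assume "k < m + 1"
        thus "poly ((pderiv ^^ k) (primitive_poly m)) 0 = 0"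
          by (subst higher_pderiv_primitive_poly_0) auto
      next
        assume "k > 2 * m + 2"
        thus "poly ((pderiv ^^ k) (primitive_poly m)) 0 = 0"
          by (subst higher_pderiv_primitive_poly_eq_0) auto
      qed
      thus "of_real (em_coeff k) * Q k 0 = 0" by simp
    qed
  qed (auto simp: K_def)
  \<comment> \<open>The factor \<open>fact k\<close> of the derivative cancels the denominator of
    \<open>em_coeff k\<close>.\<close>
  also have "\<dots> = of_real (\<Sum>k = m + 1..2 * m + 2.
     (- 1) ^ k * real ((m + 1) choose (2 * m + 2 - k)) * bernoulli_number k)"
    unfolding of_real_sum
    by (intro sum.cong) (auto simp: Q_def higher_pderiv_primitive_poly_0 em_coeff_def)
  finally show ?thesis .
qed

theorem theorem1p1:
  fixes m :: nat
  shows "fubini_study_zeta analytic_on {- of_nat m} \<and>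
    fubini_study_zeta (- of_nat m) =
      complex_of_real (- (1 / (real m + 1)) *
        (\<Sum>k = m + 1..2 * m + 2.
          (- 1) ^ k * real ((m + 1) choose (2 * m + 2 - k)) * bernoulli_number k))"
proof
  define S where "S = (\<Sum>k = m + 1..2 * m + 2.
    (- 1) ^ k * real ((m + 1) choose (2 * m + 2 - k)) * bernoulli_number k)"
  have "(- of_nat m :: complex) \<noteq> 1"
    by (auto simp: complex_eq_iff)
  note analytic = analytic_zeta_quotient[OF this]
  show "fubini_study_zeta analytic_on {- of_nat m}"
    unfolding fubini_study_zeta_eq by (rule remove_sings_analytic_on[OF analytic])
  have "fubini_study_zeta (- of_nat m) = entire_zeta (- of_nat m) / (1 + of_nat m)"
    unfolding fubini_study_zeta_eq by (simp add: remove_sings_at_analytic[OF analytic])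
  also have "\<dots> = complex_of_real (- (1 / (real m + 1)) * S)"
    unfolding entire_zeta_neg_of_nat S_def[symmetric] by (simp add: add.commute)
  finally show "fubini_study_zeta (- of_nat m) =
      complex_of_real (- (1 / (real m + 1)) *
        (\<Sum>k = m + 1..2 * m + 2.
          (- 1) ^ k * real ((m + 1) choose (2 * m + 2 - k)) * bernoulli_number k))"
    unfolding S_def .
qed

end
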